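(* For $j\ge0$ and $1\le t\le m$, we have $$\mu_{m\,t}P_j(\mu_{m\,t})=\mu_{m\,(j+1)t}-\mu_{m\,jt},\qquad \mu_{m\,t}Q_j(\mu_{m\,t})=\mu_{m\,(j+1)t}-2\mu_{m\,jt}+\mu_{m\,(j-1)t},$$ and $$\frac{\mu_{m\,(m-2j+1)t}-\mu_{m\,(m-2j)t}}{\mu_{m\,(m-j+1)t}-\mu_{m\,(m-j)t}}=\frac{\phi_{m\,(m-2j+1)t}-\phi_{m\,(m-2j)t}}{\phi_{m\,(m-j+1)t}-\phi_{m\,(m-j)t}}=\phi_{m\,jt},\qquad 1\le j\le\left[\tfrac m2\right],$$ $$\frac{\mu_{m\,(2j-m)t}-\mu_{m\,(2j-m-1)t}}{\mu_{m\,(m-j+1)t}-\mu_{m\,(m-j)t}}=\frac{\phi_{m\,(2j-m)t}-\phi_{m\,(2j-m-1)t}}{\phi_{m\,(m-j+1)t}-\phi_{m\,(m-j)t}}=-\phi_{m\,jt},\qquad \left[\tfrac m2\right]+1\le j\le m.$$ Moreover we have $$\mu_{m\,t}\prod_{k=1}^{j-1}\left(\mu_{m\,t}-\mu_{(j-1)\,k}\right)=\mu_{m\,jt}-\mu_{m\,(j-1)t}=\phi_{m\,jt}-\phi_{m\,(j-1)t},$$ $$\mu_{m\,t}\prod_{k=1}^{j}\left(\mu_{m\,t}-\nu_{j\,k}\right)=\phi_{m\,(j+1)t}-2\phi_{m\,jt}+\phi_{m\,(j-1)t},$$ so that $$\mathscr{F}_r^{(m,j)}=\sum_{t=1}^m\left(\mu_{m\,t}\right)^{-r}\left(\phi_{m\,jt}-\phi_{m\,(j-1)t}\right),\qquad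 \mathscr{G}_r^{(m,j)}=\sum_{t=1}^m\left(\mu_{m\,t}\right)^{-r}\left(\phi_{m\,(j+1)t}-2\phi_{m\,jt}+\phi_{m\,(j-1)t}\right).$$
   Context: Here $m$ is a positive integer and $[\cdot]$ is the integer part. For integers $k$ set $\phi_{m\,k}=2\cos\left(\frac{2\pi k}{2m+1}\right)$ and $\mu_{m\,k}=\phi_{m\,k}-2$ (in a subscript such as $m\,jt$ the second index is the product $jt$). The polynomials are $P_m(x)=\sum_{k=0}^{m}\frac{2m+1}{2k+1}\binom{m+k}{2k}x^{k}$ and $Q_m(x)=\sum_{k=0}^{m}\frac{m}{k}\binom{m+k-1}{2k-1}x^k$, where the $k=0$ term of $Q_m$ is read as $2$ by the limit $\lim_{k\to0}\frac{m}{k}\binom{m+k-1}{2k-1}=2$. The roots of $Q_j$, in order of increasing absolute value, are $\nu_{j\,1},\dots,\nu_{j\,j}$ (and those of $P_m$ are $\mu_{m\,1},\dots,\mu_{m\,m}$). Rational interlacing Fibonacci sequences of dimension $m$: let $h_k=\frac1{2k+1}\binom{m+k}{2k}$ and let $R_m$ be the $m\times m$ matrix whose first column is $(-h_1,-h_2,\dots,-h_m)^T$, whose entries $(i,i+1)$, $1\le i\le m-1$, equal $1$, and whose other entries are $0$ (it is invertible). Let $B_{\rm odd}$, $B_{\rm even}$ be the $m\times m$ matrices with $(i,j)$ entries $(-1)^{i+j-1}\binom{2j-1}{j-i}$ and $(-1)^{i+j}\binom{2j}{j-i}$ respectively (binomial coefficients with negative lower entry are $0$). For $1\le j\le m$ the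 sequences $\mathscr{F}_r^{(m,j)}$ and $\mathscr{G}_r^{(m,j)}$ are defined by: row $j$ of $(2m+1)B_{\rm odd}R_m^{m+r}$ is $\mathscr{F}_{r+m}^{(m,j)},\mathscr{F}_{r+m-1}^{(m,j)},\dots,\mathscr{F}_{r+1}^{(m,j)}$, and row $j$ of $(2m+1)B_{\rm even}R_m^{m+r}$ is $\mathscr{G}_{r+m}^{(m,j)},\mathscr{G}_{r+m-1}^{(m,j)},\dots,\mathscr{G}_{r+1}^{(m,j)}$.
   Formalization: The quotient identities are stated where the denominator is nonzero (it vanishes when 2m+1 divides jt, e.g. m=4, j=t=3) and, without condition, in cross-multiplied form; the two product formulas are stated for j≥1, since at j=0 with empty products they fail. *)

theory Defs
  imports Complex_Main "HOL-Computational_Algebra.Polynomial" "Jordan_Normal_Form.Determinant"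
begin

definition phi :: "nat \<Rightarrow> int \<Rightarrow> real" where
  "phi m k = 2 * cos (2 * pi * of_int k / (2 * real m + 1))"

definition mu :: "nat \<Rightarrow> int \<Rightarrow> real" where
  "mu m k = phi m k - 2"

definition P_poly :: "nat \<Rightarrow> real poly" where
  "P_poly m = (\<Sum>k=0..m. monom ((2 * real m + 1) / (2 * real k + 1) * real ((m + k) choose (2 * k))) k)"

text \<open>The constant term of \<open>Q_poly\<close> is the limit value 2, also for \<open>m = 0\<close>.\<close>

definition Q_poly :: "nat \<Rightarrow> real poly" where
  "Q_poly m = [:2:] + (\<Sum>k=1..m. monom (real m / real k * real ((m + k - 1) choose (2 * k - 1))) k)"

text \<open>\<open>nu j k\<close> is the \<open>k\<close>-th root of \<open>Q_poly j\<close> by increasing absolute value, \<open>1 \<le> k \<le> j\<close>.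
  Listing the set of real roots loses nothing: \<open>Q_poly j\<close> has \<open>j\<close> distinct roots, all real and
  negative.\<close>

definition nu :: "nat \<Rightarrow> nat \<Rightarrow> real" where
  "nu j k = sort_key abs (sorted_list_of_set {x. poly (Q_poly j) x = 0}) ! (k - 1)"

definition h_coeff :: "nat \<Rightarrow> nat \<Rightarrow> real" where
  "h_coeff m k = 1 / (2 * real k + 1) * real ((m + k) choose (2 * k))"

text \<open>Matrices of \<^theory>\<open>Jordan_Normal_Form.Matrix\<close> are indexed from 0. Below, \<open>(i, j)\<close> is the
  0-based position, and \<open>Suc i\<close>, \<open>Suc j\<close> are the 1-based indices of the formulas.\<close>

definition R_mat :: "nat \<Rightarrow> real mat" where
  "R_mat m = mat m m (\<lambda>(i, j).
     if j = 0 then - h_coeff m (Suc i) else if j = Suc i then 1 else 0)"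

definition B_odd :: "nat \<Rightarrow> real mat" where
  "B_odd m = mat m m (\<lambda>(i, j).
     if i \<le> j then (-1) ^ (Suc i + Suc j - 1) * real ((2 * Suc j - 1) choose (j - i)) else 0)"

definition B_even :: "nat \<Rightarrow> real mat" where
  "B_even m = mat m m (\<lambda>(i, j).
     if i \<le> j then (-1) ^ (Suc i + Suc j) * real ((2 * Suc j) choose (j - i)) else 0)"

text \<open>Integer powers are those of the matrix ring; \<open>R_mat m\<close> is a unit, see below.\<close>

definition R_pow :: "nat \<Rightarrow> int \<Rightarrow> real mat" where
  "R_pow m k = R_mat m [^]\<^bsub>ring_mat TYPE(real) m ()\<^esub> k"

definition odd_mat :: "nat \<Rightarrow> int \<Rightarrow> real mat" where
  "odd_mat m k = (2 * real m + 1) \<cdot>\<^sub>m (B_odd m * R_pow m k)"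

definition even_mat :: "nat \<Rightarrow> int \<Rightarrow> real mat" where
  "even_mat m k = (2 * real m + 1) \<cdot>\<^sub>m (B_even m * R_pow m k)"

text \<open>The \<open>r\<close>-th term is read off as the first entry of row \<open>j\<close> of the \<open>r\<close>-th power. The lemmas
  \<open>row_odd_mat\<close> and \<open>row_even_mat\<close> show that entire rows are the descending runs of
  consecutive terms required of these sequences.\<close>

definition F_seq :: "nat \<Rightarrow> nat \<Rightarrow> int \<Rightarrow> real" where
  "F_seq m j r = odd_mat m r $$ (j - 1, 0)"

definition G_seq :: "nat \<Rightarrow> nat \<Rightarrow> int \<Rightarrow> real" where
  "G_seq m j r = even_mat m r $$ (j - 1, 0)"

lemma R_mat_carrier [simp]: "R_mat m \<in> carrier_mat m m"
  by (simp add: R_mat_def)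

lemma R_mat_unit:
  assumes "m \<ge> 1"
  shows "R_mat m \<in> Units (ring_mat TYPE(real) m ())"
proof -
  define S where "S = mat m m (\<lambda>(i, j). if j = m - 1 then
     (if i = 0 then - 1 / h_coeff m m else - h_coeff m i / h_coeff m m)
     else if i = Suc j then 1 else 0)"
  have "(m + m) choose (2 * m) = 1"
    by (simp flip: mult_2)
  hence "h_coeff m m = 1 / (2 * real m + 1)"
    unfolding h_coeff_def by simp
  hence h: "h_coeff m m \<noteq> 0"
    by auto
  have S: "S \<in> carrier_mat m m"
    by (simp add: S_def)
  have RS: "R_mat m * S = 1\<^sub>m m"
  proof (rule eq_matI)
    fix i j assume "i < dim_row (1\<^sub>m m :: real mat)" "j < dim_col (1\<^sub>m m :: real mat)"
    hence ij: "i < m" "j < m" by auto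
    have "(R_mat m * S) $$ (i, j) = (\<Sum>k = 0..<m. R_mat m $$ (i, k) * S $$ (k, j))"
      using ij S by (simp add: scalar_prod_def R_mat_def)
    also have "\<dots> = (\<Sum>k = 0..<m. (if k = 0 then - h_coeff m (Suc i) * S $$ (0, j) else 0)
        + (if k = Suc i then S $$ (Suc i, j) else 0))"
      using ij by (intro sum.cong) (auto simp: R_mat_def)
    also have "\<dots> = - h_coeff m (Suc i) * S $$ (0, j) + (if Suc i < m then S $$ (Suc i, j) else 0)"
      using ij by (simp add: sum.distrib)
    also have "\<dots> = (1\<^sub>m m :: real mat) $$ (i, j)"
    proof (cases "Suc i < m")
      case True
      then show ?thesis using ij h by (auto simp: S_def)
    next
      case False
      hence "m = Suc i" using ij by simp
      then show ?thesis using ij h by (auto simp: S_def)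
    qed
    finally show "(R_mat m * S) $$ (i, j) = (1\<^sub>m m :: real mat) $$ (i, j)" .
  qed (auto simp: S_def R_mat_def)
  have "S * R_mat m = 1\<^sub>m m"
    using mat_mult_left_right_inverse[OF R_mat_carrier S RS] .
  with RS S show ?thesis
    by (auto simp: Units_def ring_mat_def)
qed

lemma R_pow_units_of:
  assumes "m \<ge> 1"
  shows "R_pow m k = R_mat m [^]\<^bsub>units_of (ring_mat TYPE(real) m ())\<^esub> k"
proof -
  let ?M = "ring_mat TYPE(real) m ()"
  interpret ring ?M by (rule ring_mat)
  interpret U: group "units_of ?M" by (rule units_group)
  note u = R_mat_unit[OF assms]
  have nat_eq: "R_mat m [^]\<^bsub>?M\<^esub> n = R_mat m [^]\<^bsub>units_of ?M\<^esub> n" for n :: nat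
    by (simp add: nat_pow_def units_of_def)
  have "R_mat m [^]\<^bsub>units_of ?M\<^esub> n \<in> Units ?M" for n :: nat
    using U.nat_pow_closed[of "R_mat m" n] u unfolding units_of_carrier by blast
  from units_of_inv[OF this] show ?thesis
    unfolding R_pow_def int_pow_def2 nat_eq by presburger
qed

lemma R_pow_carrier:
  assumes "m \<ge> 1"
  shows "R_pow m k \<in> carrier_mat m m"
proof -
  let ?M = "ring_mat TYPE(real) m ()"
  interpret ring ?M by (rule ring_mat)
  interpret U: group "units_of ?M" by (rule units_group)
  have "R_pow m k \<in> Units ?M"
    using U.int_pow_closed[of "R_mat m" k] R_mat_unit[OF assms]
    unfolding R_pow_units_of[OF assms] units_of_carrier by blast
  from Units_closed[OF this] show ?thesis
    by (simp add: ring_mat_simps)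
qed

lemma R_pow_Suc:
  assumes "m \<ge> 1"
  shows "R_pow m (k + 1) = R_pow m k * R_mat m"
proof -
  let ?M = "ring_mat TYPE(real) m ()"
  interpret ring ?M by (rule ring_mat)
  interpret U: group "units_of ?M" by (rule units_group)
  have u: "R_mat m \<in> carrier (units_of ?M)"
    using R_mat_unit[OF assms] by (simp add: units_of_carrier)
  show ?thesis
    unfolding R_pow_units_of[OF assms] U.int_pow_mult[OF u] U.int_pow_1[OF u]
    by (simp add: units_of_mult ring_mat_simps)
qed

lemma mult_R_mat_shift:
  assumes "A \<in> carrier_mat m m" "i < m" "Suc c < m"
  shows "(A * R_mat m) $$ (i, Suc c) = A $$ (i, c)"
proof -
  have "(A * R_mat m) $$ (i, Suc c) = (\<Sum>k = 0..<m. A $$ (i, k) * R_mat m $$ (k, Suc c))"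
    using assms by (simp add: scalar_prod_def R_mat_def)
  also have "\<dots> = (\<Sum>k = 0..<m. if k = c then A $$ (i, c) else 0)"
    using assms by (intro sum.cong) (auto simp: R_mat_def)
  also have "\<dots> = A $$ (i, c)"
    using assms by simp
  finally show ?thesis .
qed

lemma row_shift:
  assumes "m \<ge> 1" "B \<in> carrier_mat m m" "i < m" "c < m"
  shows "(B * R_pow m k) $$ (i, c) = (B * R_pow m (k - int c)) $$ (i, 0)"
  using assms(4)
proof (induction c arbitrary: k)
  case (Suc c)
  have "R_pow m k = R_pow m (k - 1) * R_mat m"
    using R_pow_Suc[OF assms(1), of "k - 1"] by simp
  hence "B * R_pow m k = (B * R_pow m (k - 1)) * R_mat m"
    using assms(2) R_pow_carrier[OF assms(1)] by (simp add: assoc_mult_mat[OF _ _ R_mat_carrier])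
  hence "(B * R_pow m k) $$ (i, Suc c) = (B * R_pow m (k - 1)) $$ (i, c)"
    using assms(2,3) Suc.prems R_pow_carrier[OF assms(1), of "k - 1"]
    by (simp add: mult_R_mat_shift)
  also have "\<dots> = (B * R_pow m (k - 1 - int c)) $$ (i, 0)"
    using Suc by simp
  finally show ?case by (simp add: algebra_simps)
qed simp

lemma row_odd_mat:
  assumes "1 \<le> j" "j \<le> m"
  shows "row (odd_mat m (int m + r)) (j - 1) = vec m (\<lambda>c. F_seq m j (r + int m - int c))"
proof -
  have m: "m \<ge> 1" using assms by simp
  have B: "B_odd m \<in> carrier_mat m m" by (simp add: B_odd_def)
  note C = R_pow_carrier[OF m]
  show ?thesis
    using assms B carrier_matD[OF C] row_shift[OF m B, of "j - 1" _ "int m + r"]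
    by (intro eq_vecI) (auto simp: odd_mat_def F_seq_def algebra_simps)
qed

lemma row_even_mat:
  assumes "1 \<le> j" "j \<le> m"
  shows "row (even_mat m (int m + r)) (j - 1) = vec m (\<lambda>c. G_seq m j (r + int m - int c))"
proof -
  have m: "m \<ge> 1" using assms by simp
  have B: "B_even m \<in> carrier_mat m m" by (simp add: B_even_def)
  note C = R_pow_carrier[OF m]
  show ?thesis
    using assms B carrier_matD[OF C] row_shift[OF m B, of "j - 1" _ "int m + r"]
    by (intro eq_vecI) (auto simp: even_mat_def G_seq_def algebra_simps)
qed

end

theory Submission
  imports Defs
begin

text \<open>Substituting \<open>x = 2 cos a - 2\<close> turns the polynomials into trigonometry:
  \<open>Q_n(x) = 2 cos (n a)\<close> and \<open>x P_n(x) = 2 cos ((n + 1) a) - 2 cos (n a)\<close>. Both follow by induction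
  from \<open>P_(n+1) = P_n + Q_(n+1)\<close> and \<open>Q_(n+1) = Q_n + x P_n\<close>, which are Pascal's rule for the
  coefficients. At \<open>a = 2 \<pi> t / (2 m + 1)\<close> this gives the two formulas for \<open>P_j\<close> and \<open>Q_j\<close>.
  It also exhibits \<open>n\<close> distinct real roots of each of the monic polynomials \<open>P_n\<close> and \<open>Q_n\<close>
  (\<open>n \<ge> 1\<close>), and hence their factorisations (\<open>prod_mu_eq_P_poly\<close>, \<open>prod_nu_eq_Q_poly\<close>). The ratios are the
  product formula \<open>\<phi>_a \<phi>_b = \<phi>_(a+b) + \<phi>_(a-b)\<close> together with \<open>\<phi>_((m+1)t) = \<phi>_(mt)\<close>.

  For the sequences, fix a root \<open>y = \<mu>_t\<close> of \<open>P_m\<close>. The row \<open>(1, y, \<dots>, y^(m-1))\<close> is a left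
  eigenvector of \<open>R_m\<close> with eigenvalue \<open>1 / y\<close>: all but the first entry of the eigenvector equation
  hold because \<open>R_m\<close> shifts columns, and the first one is \<open>P_m(y) = 0\<close>. So its product with
  \<open>R_m^r\<close> has first entry \<open>y^(-r)\<close>, for every integer \<open>r\<close> (\<open>sum_power_R_pow\<close>). What remains is to write
  the rows of \<open>(2 m + 1) B_odd\<close> and \<open>(2 m + 1) B_even\<close> as combinations of these \<open>m\<close> eigenvectors,
  with the asserted differences of \<open>\<phi>\<close> as weights. Entrywise this evaluates
  \<open>\<Sum>_t \<mu>_t^c (\<phi>_(jt) - \<phi>_((j-1)t))\<close>. Multiplication by \<open>\<mu>_t\<close> acts on \<open>k \<mapsto> \<phi>_(kt)\<close> as a second
  difference in \<open>k\<close>, so each power of \<open>\<mu>_t\<close> applies Pascal's rule twice to alternating binomial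
  coefficients, starting from plain cosine sums at \<open>c = 0\<close> (\<open>sum_mu_power_phi_diff\<close>).\<close>

section \<open>The polynomials under the substitution \<open>x = 2 cos a - 2\<close>\<close>

text \<open>Absorption removes the denominator: \<open>(2k + 1) (n+k choose 2k+1) = (n - k) (n+k choose 2k)\<close>, so the
  factor \<open>2n + 1 = (2k + 1) + 2 (n - k)\<close> splits the coefficient into binomials. In this form Pascal's
  rule yields the recurrences, with no case distinction at the ends of the range of \<open>k\<close>.\<close>

lemma coeff_P_poly:
  "coeff (P_poly n) k = real ((n + k) choose (2 * k + 1)) + real ((n + k + 1) choose (2 * k + 1))"
proof (cases "k \<le> n")
  case True
  have "coeff (P_poly n) k = (2 * real n + 1) / (2 * real k + 1) * real ((n + k) choose (2 * k))"
    using True by (simp add: P_poly_def coeff_sum)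
  hence "(2 * real k + 1) * coeff (P_poly n) k = (2 * real n + 1) * real ((n + k) choose (2 * k))"
    by simp
  moreover have "(2 * k + 1) * ((n + k) choose (2 * k + 1)) = (n - k) * ((n + k) choose (2 * k))"
  proof -
    have "Suc (2 * k) * ((n + k) choose Suc (2 * k)) = (n + k - 2 * k) * ((n + k) choose (2 * k))"
      by (simp only: binomial_absorption binomial_absorb_comp)
    thus ?thesis using True by (simp add: algebra_simps)
  qed
  hence "(2 * real k + 1) * real ((n + k) choose (2 * k + 1))
      = (real n - real k) * real ((n + k) choose (2 * k))"
    using True by (metis (no_types, lifting) of_nat_mult of_nat_diff of_nat_add of_nat_1 of_nat_numeral)
  moreover have "real ((n + k + 1) choose (2 * k + 1))
      = real ((n + k) choose (2 * k)) + real ((n + k) choose (2 * k + 1))"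
    by simp
  ultimately have *: "(2 * real k + 1) * coeff (P_poly n) k = (2 * real k + 1)
      * (real ((n + k) choose (2 * k + 1)) + real ((n + k + 1) choose (2 * k + 1)))"
    by (simp add: algebra_simps)
  have "2 * real k + 1 \<noteq> 0" by simp
  from *[unfolded mult_left_cancel[OF this]] show ?thesis .
next
  case False
  thus ?thesis by (auto simp: P_poly_def coeff_sum binomial_eq_0)
qed

lemma coeff_Q_poly:
  "coeff (Q_poly n) k = real ((n + k) choose (2 * k)) + real ((n + k - 1) choose (2 * k))"
proof (cases "1 \<le> k \<and> k \<le> n")
  case True
  then obtain l where l: "k = Suc l" by (cases k) auto
  have "coeff (Q_poly n) k = real n / real k * real ((n + k - 1) choose (2 * k - 1))"
    using True by (simp add: Q_poly_def coeff_sum l)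
  hence "real k * coeff (Q_poly n) k = real n * real ((n + k - 1) choose (2 * k - 1))"
    using l by simp
  moreover have "(2 * k) * ((n + k - 1) choose (2 * k)) = (n - k) * ((n + k - 1) choose (2 * k - 1))"
  proof -
    have "Suc (2 * l + 1) * ((n + l) choose Suc (2 * l + 1))
        = (n + l - (2 * l + 1)) * ((n + l) choose (2 * l + 1))"
      by (simp only: binomial_absorption binomial_absorb_comp)
    thus ?thesis using True by (simp add: l)
  qed
  hence "2 * real k * real ((n + k - 1) choose (2 * k))
      = (real n - real k) * real ((n + k - 1) choose (2 * k - 1))"
    using True by (metis (no_types, lifting) of_nat_mult of_nat_diff of_nat_numeral)
  moreover have "real ((n + k) choose (2 * k))
      = real ((n + k - 1) choose (2 * k - 1)) + real ((n + k - 1) choose (2 * k))"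
    by (simp add: l)
  ultimately have "2 * real k * coeff (Q_poly n) k = 2 * real k
      * (real ((n + k) choose (2 * k)) + real ((n + k - 1) choose (2 * k)))"
    using l by (simp add: algebra_simps)
  thus ?thesis using l by simp
next
  case False
  thus ?thesis by (cases k) (auto simp: Q_poly_def coeff_sum binomial_eq_0)
qed

lemma P_poly_Suc: "P_poly (Suc n) = P_poly n + Q_poly (Suc n)"
  by (rule poly_eqI) (simp add: coeff_P_poly coeff_Q_poly)

lemma Q_poly_Suc: "Q_poly (Suc n) = Q_poly n + pCons 0 (P_poly n)"
proof (rule poly_eqI)
  fix k show "coeff (Q_poly (Suc n)) k = coeff (Q_poly n + pCons 0 (P_poly n)) k"
    by (cases k) (simp_all add: coeff_P_poly coeff_Q_poly)
qed

lemma two_cos_step: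
  fixes a b :: real
  shows "(2 * cos a - 2) * (2 * cos b) = 2 * cos (b + a) - 4 * cos b + 2 * cos (b - a)"
  by (simp add: cos_add cos_diff algebra_simps)

text \<open>The two formulas form one statement because the recurrences couple \<open>P\<close> and \<open>Q\<close>.\<close>

lemma poly_P_Q_cos:
  fixes a :: real
  defines "x \<equiv> 2 * cos a - 2"
  shows "x * poly (P_poly n) x = 2 * cos ((real n + 1) * a) - 2 * cos (real n * a)
    \<and> poly (Q_poly n) x = 2 * cos (real n * a)"
proof (induction n)
  case 0
  show ?case by (simp add: P_poly_def Q_poly_def x_def)
next
  case (Suc n)
  have Q: "poly (Q_poly (Suc n)) x = 2 * cos (real (Suc n) * a)"
    using Suc by (simp add: Q_poly_Suc algebra_simps)
  have "x * poly (P_poly (Suc n)) x = x * poly (P_poly n) x + x * (2 * cos (real (Suc n) * a))"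
    by (simp add: P_poly_Suc Q distrib_left)
  also have "x * (2 * cos (real (Suc n) * a)) = 2 * cos (real (Suc n) * a + a)
      - 4 * cos (real (Suc n) * a) + 2 * cos (real (Suc n) * a - a)"
    unfolding x_def by (rule two_cos_step)
  finally show ?case using Suc Q by (simp add: algebra_simps)
qed

section \<open>Monic polynomials and their roots\<close>

lemma degree_P_poly_le: "degree (P_poly n) \<le> n"
  by (rule degree_le) (auto simp: coeff_P_poly binomial_eq_0)

lemma degree_Q_poly_le: "degree (Q_poly n) \<le> n"
  by (rule degree_le) (auto simp: coeff_Q_poly binomial_eq_0)

lemma monic_eq_prod_roots:
  fixes p :: "'a :: idom poly"
  assumes "finite S" "card S = n" "degree p \<le> n" "coeff p n = 1" "\<And>a. a \<in> S \<Longrightarrow> poly p a = 0"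
  shows "p = (\<Prod>a\<in>S. [:- a, 1:])"
proof (rule poly_eqI_degree_lead_coeff[where A = S and n = n])
  have deg: "degree (\<Prod>a\<in>S. [:- a, 1:]) = n"
    using assms(2) by (subst degree_prod_eq_sum_degree) auto
  thus "degree (\<Prod>a\<in>S. [:- a, 1:]) \<le> n" by simp
  have "lead_coeff (\<Prod>a\<in>S. [:- a, 1:]) = 1"
    by (simp add: lead_coeff_prod)
  thus "coeff p n = coeff (\<Prod>a\<in>S. [:- a, 1:]) n"
    using assms(4) deg by simp
  show "poly p a = poly (\<Prod>a\<in>S. [:- a, 1:]) a" if "a \<in> S" for a
    using that assms(1,5) by (auto simp: poly_prod intro!: prod_zero[symmetric])
qed (use assms in auto)

section \<open>Identities for \<open>\<phi>\<close> and \<open>\<mu>\<close>\<close>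

lemma phi_mult: "phi m a * phi m b = phi m (a + b) + phi m (a - b)"
  by (simp add: phi_def cos_add cos_diff distrib_left right_diff_distrib add_divide_distrib
      diff_divide_distrib)

lemma phi_minus [simp]: "phi m (- a) = phi m a"
  by (simp add: phi_def)

lemma phi_0 [simp]: "phi m 0 = 2"
  by (simp add: phi_def)

lemma phi_reflect:
  assumes "a + b = (2 * int m + 1) * c"
  shows "phi m a = phi m b"
proof -
  have "real_of_int (a + b) = (2 * real m + 1) * of_int c"
    unfolding assms by simp
  hence a: "real_of_int a = (2 * real m + 1) * of_int c - of_int b"
    by simp
  have "2 * pi * of_int a / (2 * real m + 1) = 2 * pi * of_int c - 2 * pi * of_int b / (2 * real m + 1)"
    unfolding a by (simp add: right_diff_distrib diff_divide_distrib)
  thus ?thesis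
    by (simp add: phi_def cos_diff)
qed

text \<open>By the product formula each product on the right yields the wanted term on the left and one extra
  term; the extra terms \<open>\<phi>_((m+1)t)\<close> and \<open>\<phi>_(mt)\<close> agree and cancel.\<close>

lemma phi_diff_half_step:
  "phi m ((int m - 2 * j + 1) * t) - phi m ((int m - 2 * j) * t)
    = phi m (j * t) * (phi m ((int m - j + 1) * t) - phi m ((int m - j) * t))"
proof -
  have "phi m ((int m + 1) * t) = phi m (int m * t)"
    by (rule phi_reflect[where c = t]) (simp add: algebra_simps)
  moreover have "phi m (j * t) * phi m ((int m - j + 1) * t)
      = phi m ((int m + 1) * t) + phi m (- ((int m - 2 * j + 1) * t))"
    unfolding phi_mult by (simp add: algebra_simps)
  moreover have "phi m (j * t) * phi m ((int m - j) * t)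
      = phi m (int m * t) + phi m (- ((int m - 2 * j) * t))"
    unfolding phi_mult by (simp add: algebra_simps)
  ultimately show ?thesis by (simp add: right_diff_distrib)
qed

lemma phi_diff_half_step_reflected:
  "phi m ((2 * j - int m) * t) - phi m ((2 * j - int m - 1) * t)
    = - phi m (j * t) * (phi m ((int m - j + 1) * t) - phi m ((int m - j) * t))"
proof -
  have "(2 * j - int m) * t = - ((int m - 2 * j) * t)"
    "(2 * j - int m - 1) * t = - ((int m - 2 * j + 1) * t)"
    by (simp_all add: algebra_simps)
  thus ?thesis using phi_diff_half_step[of m j t] by (simp only: phi_minus)
qed

lemma mu_angle_le_pi:
  assumes "t \<le> m"
  shows "2 * pi * real t / (2 * real m + 1) \<le> pi"
proof -
  have "pi * (2 * real t) \<le> pi * (2 * real m + 1)"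
    using assms by (intro mult_left_mono) auto
  thus ?thesis by (simp add: field_simps)
qed

lemma mu_nonzero:
  assumes "1 \<le> t" "t \<le> m"
  shows "mu m (int t) \<noteq> 0"
proof -
  have "cos (2 * pi * real t / (2 * real m + 1)) < cos 0"
    using assms mu_angle_le_pi[of t m] by (intro cos_monotone_0_pi) auto
  thus ?thesis by (simp add: mu_def phi_def)
qed

lemma inj_on_mu: "inj_on (\<lambda>k. mu n (int k)) {1..n}"
proof (rule inj_onI)
  fix k l assume kl: "k \<in> {1..n}" "l \<in> {1..n}" "mu n (int k) = mu n (int l)"
  have "cos (2 * pi * real k / (2 * real n + 1)) = cos (2 * pi * real l / (2 * real n + 1))"
    using kl(3) by (simp add: mu_def phi_def)
  hence "2 * pi * real k / (2 * real n + 1) = 2 * pi * real l / (2 * real n + 1)"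
    by (rule cos_inj_pi[OF _ mu_angle_le_pi _ mu_angle_le_pi, rotated -1]) (use kl in auto)
  thus "k = l" by simp
qed

lemma mu_times_P_poly:
  "mu m t * poly (P_poly n) (mu m t) = phi m ((int n + 1) * t) - phi m (int n * t)"
  using poly_P_Q_cos[of "2 * pi * of_int t / (2 * real m + 1)" n]
  by (simp add: mu_def phi_def mult_ac)

lemma poly_Q_poly_mu: "poly (Q_poly n) (mu m t) = phi m (int n * t)"
  using poly_P_Q_cos[of "2 * pi * of_int t / (2 * real m + 1)" n]
  by (simp add: mu_def phi_def mult_ac)

lemma mu_times_phi: "mu m t * phi m k = phi m (k + t) - 2 * phi m k + phi m (k - t)"
  using phi_mult[of m k t] by (simp add: mu_def algebra_simps)

text \<open>The indices \<open>(m + 1) t\<close> and \<open>m t\<close> add up to the multiple \<open>(2m + 1) t\<close> of the period, so \<open>\<phi>\<close>, being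
  even, agrees at both, and the difference \<open>\<phi>_((m+1)t) - \<phi>_(mt)\<close> that equals \<open>\<mu>_t P_m(\<mu>_t)\<close> vanishes.\<close>

lemma P_poly_mu_root:
  assumes "1 \<le> t" "t \<le> m"
  shows "poly (P_poly m) (mu m (int t)) = 0"
proof -
  have "phi m ((int m + 1) * int t) = phi m (int m * int t)"
    by (rule phi_reflect[where c = "int t"]) (simp add: algebra_simps)
  hence "mu m (int t) * poly (P_poly m) (mu m (int t)) = 0"
    by (simp add: mu_times_P_poly)
  thus ?thesis using mu_nonzero[OF assms] by simp
qed

lemma prod_mu_eq_P_poly: "(\<Prod>k=1..n. x - mu n (int k)) = poly (P_poly n) x"
proof -
  have "P_poly n = (\<Prod>a\<in>(\<lambda>k. mu n (int k)) ` {1..n}. [:- a, 1:])"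
    using inj_on_mu[of n] degree_P_poly_le[of n]
    by (intro monic_eq_prod_roots[where n = n])
       (auto simp: card_image P_poly_mu_root coeff_P_poly simp flip: mult_2)
  thus ?thesis
    using inj_on_mu[of n] by (simp add: prod.reindex poly_prod)
qed

text \<open>Since \<open>Q_n(2 cos a - 2) = 2 cos (n a)\<close>, the roots come from the \<open>n\<close> angles
  \<open>a = (k - 1/2) \<pi> / n\<close> in \<open>[0, \<pi>]\<close>.\<close>

lemma card_Q_poly_roots:
  assumes "n \<ge> 1"
  shows "finite {x. poly (Q_poly n) x = 0}" "card {x. poly (Q_poly n) x = 0} = n"
proof -
  define a where "a = (\<lambda>k. (real k - 1 / 2) * pi / real n)"
  have "coeff (Q_poly n) n = 1"
    using assms by (simp add: coeff_Q_poly flip: mult_2)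
  hence Q0: "Q_poly n \<noteq> 0" by auto
  thus fin: "finite {x. poly (Q_poly n) x = 0}" by (rule poly_roots_finite)
  have "inj_on (\<lambda>k. 2 * cos (a k) - 2) {1..n}"
  proof (rule inj_onI)
    fix k l assume kl: "k \<in> {1..n}" "l \<in> {1..n}" "2 * cos (a k) - 2 = 2 * cos (a l) - 2"
    have "0 \<le> a i \<and> a i \<le> pi" if "i \<in> {1..n}" for i
    proof -
      have "(real i - 1 / 2) * pi \<le> real n * pi"
        using that by (intro mult_right_mono) auto
      thus ?thesis using that assms by (auto simp: a_def field_simps)
    qed
    hence "a k = a l" using kl by (auto intro: cos_inj_pi[of "a k" "a l"])
    thus "k = l" using assms by (simp add: a_def)
  qed
  moreover have "poly (Q_poly n) (2 * cos (a k) - 2) = 0" for k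
  proof -
    have "real n * a k = real k * pi - pi / 2"
      using assms by (simp add: a_def field_simps)
    thus ?thesis using poly_P_Q_cos[of "a k" n] by (simp add: cos_diff)
  qed
  ultimately have "n \<le> card {x. poly (Q_poly n) x = 0}"
    using card_mono[OF fin, of "(\<lambda>k. 2 * cos (a k) - 2) ` {1..n}"] by (auto simp: card_image)
  moreover have "card {x. poly (Q_poly n) x = 0} \<le> n"
    using card_poly_roots_bound[OF Q0] degree_Q_poly_le[of n] by simp
  ultimately show "card {x. poly (Q_poly n) x = 0} = n" by simp
qed

text \<open>The numbers \<open>\<nu>\<close> list the root set without repetition, so the product over
  positions is the product over the set of roots.\<close>

lemma prod_nu_eq_Q_poly:
  assumes "n \<ge> 1"
  shows "(\<Prod>k=1..n. x - nu n k) = poly (Q_poly n) x"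
proof -
  let ?S = "{x. poly (Q_poly n) x = 0}"
  define xs where "xs = sort_key abs (sorted_list_of_set ?S)"
  note S = card_Q_poly_roots[OF assms]
  have xs: "distinct xs" "set xs = ?S" "length xs = n"
    using S by (simp_all add: xs_def)
  have "(\<Prod>k=1..n. x - nu n k) = (\<Prod>k=Suc 0..<Suc n. x - xs ! (k - 1))"
    by (intro prod.cong) (auto simp: nu_def xs_def)
  also have "\<dots> = (\<Prod>i=0..<n. x - xs ! i)"
    by (subst prod.shift_bounds_Suc_ivl) simp
  also have "\<dots> = prod_list (map (\<lambda>a. x - a) xs)"
    using xs(3) by (simp add: prod.list_conv_set_nth)
  also have "\<dots> = (\<Prod>a\<in>?S. x - a)"
    using prod.distinct_set_conv_list[OF xs(1), of "\<lambda>a. x - a"] xs(2) by simp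
  also have "\<dots> = poly (\<Prod>a\<in>?S. [:- a, 1:]) x"
    by (simp add: poly_prod)
  also have "(\<Prod>a\<in>?S. [:- a, 1:]) = Q_poly n"
    using S degree_Q_poly_le[of n] assms
    by (intro monic_eq_prod_roots[symmetric, where n = n])
       (auto simp: coeff_Q_poly simp flip: mult_2)
  finally show ?thesis .
qed

section \<open>Power sums weighted by cosines\<close>

text \<open>The Dirichlet kernel: with \<open>b = \<pi> k / (2m + 1)\<close>, multiplication by \<open>sin b\<close> makes the sum
  telescope to \<open>sin (\<pi> k) - sin b\<close>, and \<open>sin b\<close> does not vanish because \<open>2m + 1\<close> does not divide
  \<open>k\<close>.\<close>

lemma sum_phi:
  assumes "k \<noteq> 0" "\<bar>k\<bar> \<le> 2 * int m"
  shows "(\<Sum>t=1..m. phi m (k * int t)) = - 1"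
proof -
  define b where "b = pi * of_int k / (2 * real m + 1)"
  have "sin b \<noteq> 0"
  proof
    assume "sin b = 0"
    then obtain i :: int where i: "b = of_int i * pi" by (auto simp: sin_zero_iff_int2)
    hence "pi * of_int k = pi * of_int (i * (2 * int m + 1))"
      by (simp add: b_def field_simps)
    hence "real_of_int k = of_int (i * (2 * int m + 1))"
      by (simp only: mult_left_cancel[OF pi_neq_zero])
    hence "k = i * (2 * int m + 1)" by linarith
    hence "(2 * int m + 1) dvd k" by simp
    from dvd_imp_le_int[OF assms(1) this] show False using assms(2) by simp
  qed
  have tele: "sin b * (\<Sum>t=1..n. phi m (k * int t)) = sin ((2 * real n + 1) * b) - sin b" for n
  proof (induction n)
    case (Suc n)
    have "2 * pi * of_int (k * int (Suc n)) / (2 * real m + 1) = (2 * real n + 2) * b"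
      by (simp add: b_def field_simps)
    hence "sin b * phi m (k * int (Suc n)) = 2 * sin b * cos ((2 * real n + 2) * b)"
      by (simp add: phi_def)
    also have "\<dots> = sin ((2 * real n + 2) * b + b) - sin ((2 * real n + 2) * b - b)"
      by (simp add: sin_add sin_diff)
    finally show ?case using Suc by (simp add: algebra_simps)
  qed simp
  have "(2 * real m + 1) * b = pi * of_int k"
    by (simp add: b_def field_simps)
  hence "sin ((2 * real m + 1) * b) = 0" by simp
  hence "sin b * (\<Sum>t=1..m. phi m (k * int t)) = sin b * - 1"
    using tele[of m] by simp
  thus ?thesis unfolding mult_left_cancel[OF \<open>sin b \<noteq> 0\<close>] .
qed

text \<open>The coefficient of \<open>X^k\<close> in \<open>(1 - X)^n\<close>. An integer index makes Pascal's rule hold everywhere,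
  including the border of the triangle.\<close>

definition signed_binomial :: "nat \<Rightarrow> int \<Rightarrow> real" where
  "signed_binomial n k = (if k < 0 then 0 else (- 1) ^ nat k * real (n choose nat k))"

lemma signed_binomial_Suc: "signed_binomial (Suc n) k = signed_binomial n k - signed_binomial n (k - 1)"
proof (cases "k > 0")
  case True
  then obtain l where "k = int (Suc l)" by (metis pos_int_cases Suc_pred)
  thus ?thesis by (simp add: signed_binomial_def nat_add_distrib algebra_simps)
qed (auto simp: signed_binomial_def)

text \<open>In the induction on \<open>c\<close>, the factor \<open>\<mu>_t\<close> replaces the weight for \<open>j\<close> by its second difference
  in \<open>j\<close>; the right-hand side satisfies the same recursion by Pascal's rule. The induction step needs \<open>j - 1\<close> and
  \<open>j + 1\<close>, so \<open>j\<close> has to run through all integers, zero and negative ones included. The bounds on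
  \<open>j\<close> ensure that the base case only meets cosine sums whose frequency is at most \<open>2m\<close> in absolute
  value; beyond it the sums repeat with period \<open>2m + 1\<close>, which the binomials do not.\<close>

lemma sum_mu_power_phi_diff:
  assumes "int c + 1 \<le> j + 2 * int m" "j + int c \<le> 2 * int m"
  shows "(\<Sum>t=1..m. mu m (int t) ^ c * (phi m (j * int t) - phi m ((j - 1) * int t)))
     = - (2 * real m + 1) * signed_binomial (2 * c + 1) (int c + 1 - j)"
  using assms
proof (induction c arbitrary: j)
  case 0
  (* The two boundary terms j = 0 and j = 1 are the only ones where the frequency 0 enters. *)
  have *: "(\<Sum>t=1..m. phi m (k * int t)) = (if k = 0 then 2 * real m else - 1)"
    if "\<bar>k\<bar> \<le> 2 * int m" for k
    using that sum_phi[of k m] by auto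
  have "signed_binomial 1 k = (if k = 0 then 1 else if k = 1 then - 1 else 0)" for k
    by (auto simp: signed_binomial_def binomial_eq_0)
  thus ?case using 0 *[of j] *[of "j - 1"] by (simp add: sum_subtractf)
next
  case (Suc c)
  let ?E = "\<lambda>j t. phi m (j * int t) - phi m ((j - 1) * int t)"
  have "mu m (int t) ^ Suc c * ?E j t = mu m (int t) ^ c * ?E (j + 1) t
      - 2 * (mu m (int t) ^ c * ?E j t) + mu m (int t) ^ c * ?E (j - 1) t" for t
  proof -
    have "mu m (int t) * ?E j t = ?E (j + 1) t - 2 * ?E j t + ?E (j - 1) t"
      using mu_times_phi[of m "int t" "j * int t"] mu_times_phi[of m "int t" "(j - 1) * int t"]
      by (simp add: algebra_simps)
    hence "mu m (int t) ^ c * (mu m (int t) * ?E j t)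
        = mu m (int t) ^ c * (?E (j + 1) t - 2 * ?E j t + ?E (j - 1) t)"
      by simp
    thus ?thesis
      by (simp only: power_Suc2 mult.assoc)
         (simp only: distrib_left right_diff_distrib mult.left_commute)
  qed
  hence "(\<Sum>t=1..m. mu m (int t) ^ Suc c * ?E j t)
      = (\<Sum>t=1..m. mu m (int t) ^ c * ?E (j + 1) t)
        - 2 * (\<Sum>t=1..m. mu m (int t) ^ c * ?E j t)
        + (\<Sum>t=1..m. mu m (int t) ^ c * ?E (j - 1) t)"
    by (simp only: sum.distrib sum_subtractf sum_distrib_left)
  also have "\<dots> = - (2 * real m + 1) * (signed_binomial (2 * c + 1) (int c - j)
      - 2 * signed_binomial (2 * c + 1) (int c + 1 - j) + signed_binomial (2 * c + 1) (int c + 2 - j))"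
    using Suc.IH[of "j + 1"] Suc.IH[of j] Suc.IH[of "j - 1"] Suc.prems
    by (simp add: algebra_simps)
  also have "signed_binomial (2 * c + 1) (int c - j) - 2 * signed_binomial (2 * c + 1) (int c + 1 - j)
      + signed_binomial (2 * c + 1) (int c + 2 - j) = signed_binomial (2 * Suc c + 1) (int (Suc c) + 1 - j)"
    by (simp add: signed_binomial_Suc algebra_simps)
  finally show ?case .
qed

text \<open>The second difference is a difference of two first differences, so the two binomials for \<open>j\<close> and
  \<open>j + 1\<close> merge by one more use of Pascal's rule.\<close>

lemma sum_mu_power_phi_diff2:
  assumes "int c + 1 \<le> j + 2 * int m" "j + 1 + int c \<le> 2 * int m"
  shows "(\<Sum>t=1..m. mu m (int t) ^ c
       * (phi m ((j + 1) * int t) - 2 * phi m (j * int t) + phi m ((j - 1) * int t)))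
     = (2 * real m + 1) * signed_binomial (2 * c + 2) (int c + 1 - j)"
proof -
  have "(\<Sum>t=1..m. mu m (int t) ^ c
       * (phi m ((j + 1) * int t) - 2 * phi m (j * int t) + phi m ((j - 1) * int t)))
    = (\<Sum>t=1..m. mu m (int t) ^ c * (phi m ((j + 1) * int t) - phi m ((j + 1 - 1) * int t)))
    - (\<Sum>t=1..m. mu m (int t) ^ c * (phi m (j * int t) - phi m ((j - 1) * int t)))"
    unfolding sum_subtractf[symmetric] by (intro sum.cong) (simp_all add: algebra_simps)
  also have "\<dots> = (2 * real m + 1) * (signed_binomial (2 * c + 1) (int c + 1 - j)
      - signed_binomial (2 * c + 1) (int c - j))"
    using sum_mu_power_phi_diff[of c "j + 1" m] sum_mu_power_phi_diff[of c j m] assms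
    by (simp add: algebra_simps)
  finally show ?thesis by (simp add: signed_binomial_Suc)
qed

lemma B_odd_entry:
  assumes "i < m" "c < m"
  shows "B_odd m $$ (i, c) = - signed_binomial (2 * c + 1) (int c - int i)"
proof (cases "i \<le> c")
  case True
  then obtain d where "c = i + d" by (auto simp: le_iff_add)
  thus ?thesis using assms by (simp add: B_odd_def signed_binomial_def power_add)
qed (use assms in \<open>simp add: B_odd_def signed_binomial_def\<close>)

lemma B_even_entry:
  assumes "i < m" "c < m"
  shows "B_even m $$ (i, c) = signed_binomial (2 * c + 2) (int c - int i)"
proof (cases "i \<le> c")
  case True
  then obtain d where "c = i + d" by (auto simp: le_iff_add)
  thus ?thesis using assms by (simp add: B_even_def signed_binomial_def power_add)
qed (use assms in \<open>simp add: B_even_def signed_binomial_def\<close>)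

section \<open>Integer powers of \<open>R_m\<close> acting on eigenvectors\<close>

text \<open>The factor is split off on the left so that it acts first on a row vector standing to the left of
  the power.\<close>

lemma R_pow_Suc_left:
  assumes "m \<ge> 1"
  shows "R_pow m (k + 1) = R_mat m * R_pow m k"
proof -
  let ?M = "ring_mat TYPE(real) m ()"
  interpret ring ?M by (rule ring_mat)
  interpret U: group "units_of ?M" by (rule units_group)
  have u: "R_mat m \<in> carrier (units_of ?M)"
    using R_mat_unit[OF assms] by (simp add: units_of_carrier)
  have "R_pow m (1 + k) = R_mat m * R_pow m k"
    unfolding R_pow_units_of[OF assms] U.int_pow_mult[OF u] U.int_pow_1[OF u]
    by (simp add: units_of_mult ring_mat_simps)
  thus ?thesis by (simp add: add.commute)
qed

lemma R_pow_0: "m \<ge> 1 \<Longrightarrow> R_pow m 0 = 1\<^sub>m m"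
  by (simp add: R_pow_def ring_mat_simps)

text \<open>The rows of \<open>v\<close> are left eigenvectors. Raising the exponent by one multiplies by \<open>a\<close>; as \<open>a\<close> is
  nonzero, this relation can also be read downwards, which covers the negative powers.\<close>

lemma left_eigen_R_pow:
  assumes m: "m \<ge> 1" and v: "v \<in> carrier_mat n m" and a: "a \<noteq> 0"
    and eig: "v * R_mat m = a \<cdot>\<^sub>m v"
  shows "v * R_pow m k = (a powi k) \<cdot>\<^sub>m v"
proof -
  note C = R_pow_carrier[OF m]
  have step: "v * R_pow m (k + 1) = a \<cdot>\<^sub>m (v * R_pow m k)" for k
    using v C[of k] by (simp add: R_pow_Suc_left[OF m] eig mult_smult_assoc_mat[OF v C]
        flip: assoc_mult_mat[OF v R_mat_carrier C])
  show ?thesis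
  proof (induction k rule: int_induct[where k = 0])
    case base
    show ?case using v by (auto simp: R_pow_0[OF m] intro!: eq_matI)
  next
    case (step1 i)
    have "v * R_pow m (i + 1) = a \<cdot>\<^sub>m ((a powi i) \<cdot>\<^sub>m v)"
      by (simp only: step step1)
    also have "\<dots> = (a powi (i + 1)) \<cdot>\<^sub>m v"
      using a v by (intro eq_matI) (auto simp: power_int_add)
    finally show ?case .
  next
    case (step2 i)
    have "a \<cdot>\<^sub>m (v * R_pow m (i - 1)) = (a powi i) \<cdot>\<^sub>m v"
      using step[of "i - 1"] step2 by simp
    moreover have "v * R_pow m (i - 1) = inverse a \<cdot>\<^sub>m (a \<cdot>\<^sub>m (v * R_pow m (i - 1)))"
      using a by (intro eq_matI) auto
    ultimately have "v * R_pow m (i - 1) = inverse a \<cdot>\<^sub>m ((a powi i) \<cdot>\<^sub>m v)"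
      by simp
    also have "\<dots> = (a powi (i - 1)) \<cdot>\<^sub>m v"
      using a v by (intro eq_matI) (auto simp: power_int_diff field_simps)
    finally show ?case .
  qed
qed

lemma P_poly_eq_h_coeff:
  "poly (P_poly m) y = (2 * real m + 1) * (\<Sum>k=0..m. h_coeff m k * y ^ k)"
  by (simp add: P_poly_def h_coeff_def poly_sum poly_monom sum_distrib_left mult.assoc)

text \<open>The sum is the first entry of the product of the row \<open>(1, y, \<dots>, y^(m-1))\<close> with a power of \<open>R_m\<close>.
  That row is an eigenvector with eigenvalue \<open>1 / y\<close>; the equation in its first entry says
  \<open>1 + \<Sum>_(k\<ge>1) h_k y^k = 0\<close>, which is \<open>P_m(y) = 0\<close> up to the factor \<open>2m + 1\<close>.\<close>

lemma sum_power_R_pow: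
  assumes m: "m \<ge> 1" and y: "y \<noteq> 0" "poly (P_poly m) y = 0"
  shows "(\<Sum>c<m. y ^ c * R_pow m r $$ (c, 0)) = y powi (- r)"
proof -
  define v where "v = mat 1 m (\<lambda>(_, c). y ^ c)"
  have v: "v \<in> carrier_mat 1 m" by (simp add: v_def)
  have "0 = (\<Sum>k=0..m. h_coeff m k * y ^ k)"
    using y(2) by (simp add: P_poly_eq_h_coeff add_nonneg_eq_0_iff)
  also have "\<dots> = (\<Sum>k<Suc m. h_coeff m k * y ^ k)"
    by (intro sum.cong) auto
  also have "\<dots> = 1 + y * (\<Sum>k<m. y ^ k * h_coeff m (Suc k))"
    unfolding sum.lessThan_Suc_shift by (simp add: h_coeff_def sum_distrib_left mult_ac)
  finally have "y * (\<Sum>k<m. y ^ k * h_coeff m (Suc k)) = y * - inverse y"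
    using y(1) by simp
  hence h: "(\<Sum>k<m. y ^ k * h_coeff m (Suc k)) = - inverse y"
    unfolding mult_left_cancel[OF y(1)] .
  have "v * R_mat m = inverse y \<cdot>\<^sub>m v"
  proof (rule eq_matI)
    fix i j assume "i < dim_row (inverse y \<cdot>\<^sub>m v)" "j < dim_col (inverse y \<cdot>\<^sub>m v)"
    hence ij: "i = 0" "j < m" by (auto simp: v_def)
    show "(v * R_mat m) $$ (i, j) = (inverse y \<cdot>\<^sub>m v) $$ (i, j)"
    proof (cases j)
      case 0
      have "(v * R_mat m) $$ (i, j) = (\<Sum>k<m. y ^ k * - h_coeff m (Suc k))"
        using ij m 0 by (simp add: v_def R_mat_def scalar_prod_def lessThan_atLeast0)
      also have "\<dots> = inverse y" using h by (simp add: sum_negf)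
      finally show ?thesis using ij m 0 by (simp add: v_def)
    next
      case (Suc l)
      have "(v * R_mat m) $$ (i, j) = (\<Sum>k<m. y ^ k * (if l = k then 1 else 0))"
        using ij Suc by (simp add: v_def R_mat_def scalar_prod_def lessThan_atLeast0)
      also have "\<dots> = (\<Sum>k<m. if l = k then y ^ k else 0)"
        by (intro sum.cong) auto
      also have "\<dots> = y ^ l" using ij Suc by simp
      finally show ?thesis using ij Suc y(1) by (simp add: v_def)
    qed
  qed (simp_all add: v_def R_mat_def)
  hence *: "v * R_pow m r = (inverse y powi r) \<cdot>\<^sub>m v"
    using y(1) by (intro left_eigen_R_pow[OF m v]) auto
  have "(\<Sum>c<m. y ^ c * R_pow m r $$ (c, 0)) = (v * R_pow m r) $$ (0, 0)"
    using R_pow_carrier[OF m, of r] m by (simp add: v_def scalar_prod_def lessThan_atLeast0)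
  also have "\<dots> = y powi (- r)"
    unfolding * using m by (simp add: v_def power_int_minus power_int_inverse)
  finally show ?thesis .
qed

text \<open>If row \<open>i\<close> of \<open>(2m + 1) B\<close> is a combination of the eigenvectors \<open>(\<mu>_t^c)\<^sub>c\<close> with weights \<open>w t\<close>,
  then powers of \<open>R_m\<close> act on it by multiplying the weights with powers of \<open>1 / \<mu>_t\<close>.\<close>

lemma first_column_expansion:
  assumes m: "m \<ge> 1" and B: "B \<in> carrier_mat m m" and i: "i < m"
    and w: "\<And>c. c < m \<Longrightarrow> (2 * real m + 1) * B $$ (i, c) = (\<Sum>t=1..m. mu m (int t) ^ c * w t)"
  shows "((2 * real m + 1) \<cdot>\<^sub>m (B * R_pow m r)) $$ (i, 0) = (\<Sum>t=1..m. mu m (int t) powi (- r) * w t)"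
proof -
  have "((2 * real m + 1) \<cdot>\<^sub>m (B * R_pow m r)) $$ (i, 0)
      = (\<Sum>c<m. ((2 * real m + 1) * B $$ (i, c)) * R_pow m r $$ (c, 0))"
    using B R_pow_carrier[OF m, of r] i m
    by (simp add: scalar_prod_def lessThan_atLeast0 sum_distrib_left mult.assoc)
  also have "\<dots> = (\<Sum>c<m. \<Sum>t=1..m. mu m (int t) ^ c * w t * R_pow m r $$ (c, 0))"
    using w by (simp add: sum_distrib_right)
  also have "\<dots> = (\<Sum>t=1..m. (\<Sum>c<m. mu m (int t) ^ c * R_pow m r $$ (c, 0)) * w t)"
    by (subst sum.swap) (simp add: sum_distrib_left sum_distrib_right mult_ac)
  also have "\<dots> = (\<Sum>t=1..m. mu m (int t) powi (- r) * w t)"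
    by (intro sum.cong refl) (simp add: sum_power_R_pow[OF m] mu_nonzero P_poly_mu_root)
  finally show ?thesis .
qed

section \<open>Closed forms of the two sequences\<close>

lemma F_seq_eq:
  assumes "1 \<le> j" "j \<le> m"
  shows "F_seq m j r = (\<Sum>t=1..m. mu m (int t) powi (- r)
    * (phi m (int j * int t) - phi m ((int j - 1) * int t)))"
  unfolding F_seq_def odd_mat_def
proof (rule first_column_expansion)
  show "(2 * real m + 1) * B_odd m $$ (j - 1, c)
      = (\<Sum>t=1..m. mu m (int t) ^ c * (phi m (int j * int t) - phi m ((int j - 1) * int t)))"
    if "c < m" for c
    using that assms sum_mu_power_phi_diff[of c "int j" m] B_odd_entry[of "j - 1" m c]
    by (simp add: of_nat_diff algebra_simps)
qed (use assms in \<open>auto simp: B_odd_def\<close>)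

lemma G_seq_eq:
  assumes "1 \<le> j" "j \<le> m"
  shows "G_seq m j r = (\<Sum>t=1..m. mu m (int t) powi (- r)
    * (phi m ((int j + 1) * int t) - 2 * phi m (int j * int t) + phi m ((int j - 1) * int t)))"
  unfolding G_seq_def even_mat_def
proof (rule first_column_expansion)
  show "(2 * real m + 1) * B_even m $$ (j - 1, c)
      = (\<Sum>t=1..m. mu m (int t) ^ c
        * (phi m ((int j + 1) * int t) - 2 * phi m (int j * int t) + phi m ((int j - 1) * int t)))"
    if "c < m" for c
    using that assms sum_mu_power_phi_diff2[of c "int j" m] B_even_entry[of "j - 1" m c]
    by (simp add: of_nat_diff algebra_simps)
qed (use assms in \<open>auto simp: B_even_def\<close>)

theorem lemma3p2:
  fixes m :: nat
  assumes "m \<ge> 1"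
  shows
    "(\<forall>j t :: nat. 1 \<le> t \<and> t \<le> m \<longrightarrow>
       mu m (int t) * poly (P_poly j) (mu m (int t))
         = mu m ((int j + 1) * int t) - mu m (int j * int t)
     \<and> mu m (int t) * poly (Q_poly j) (mu m (int t))
         = mu m ((int j + 1) * int t) - 2 * mu m (int j * int t) + mu m ((int j - 1) * int t))
     \<and>
     (\<forall>j t :: nat. 1 \<le> t \<and> t \<le> m \<and> 1 \<le> j \<and> j \<le> m div 2 \<longrightarrow>
       phi m ((int m - 2 * int j + 1) * int t) - phi m ((int m - 2 * int j) * int t)
         = phi m (int j * int t)
           * (phi m ((int m - int j + 1) * int t) - phi m ((int m - int j) * int t))
     \<and> (phi m ((int m - int j + 1) * int t) - phi m ((int m - int j) * int t) \<noteq> 0 \<longrightarrow>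
         (mu m ((int m - 2 * int j + 1) * int t) - mu m ((int m - 2 * int j) * int t))
           / (mu m ((int m - int j + 1) * int t) - mu m ((int m - int j) * int t))
         = (phi m ((int m - 2 * int j + 1) * int t) - phi m ((int m - 2 * int j) * int t))
           / (phi m ((int m - int j + 1) * int t) - phi m ((int m - int j) * int t))
       \<and> (phi m ((int m - 2 * int j + 1) * int t) - phi m ((int m - 2 * int j) * int t))
           / (phi m ((int m - int j + 1) * int t) - phi m ((int m - int j) * int t))
         = phi m (int j * int t)))
     \<and>
     (\<forall>j t :: nat. 1 \<le> t \<and> t \<le> m \<and> m div 2 + 1 \<le> j \<and> j \<le> m \<longrightarrow>
       phi m ((2 * int j - int m) * int t) - phi m ((2 * int j - int m - 1) * int t)
         = - phi m (int j * int t)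
           * (phi m ((int m - int j + 1) * int t) - phi m ((int m - int j) * int t))
     \<and> (phi m ((int m - int j + 1) * int t) - phi m ((int m - int j) * int t) \<noteq> 0 \<longrightarrow>
         (mu m ((2 * int j - int m) * int t) - mu m ((2 * int j - int m - 1) * int t))
           / (mu m ((int m - int j + 1) * int t) - mu m ((int m - int j) * int t))
         = (phi m ((2 * int j - int m) * int t) - phi m ((2 * int j - int m - 1) * int t))
           / (phi m ((int m - int j + 1) * int t) - phi m ((int m - int j) * int t))
       \<and> (phi m ((2 * int j - int m) * int t) - phi m ((2 * int j - int m - 1) * int t))
           / (phi m ((int m - int j + 1) * int t) - phi m ((int m - int j) * int t))
         = - phi m (int j * int t)))
     \<and>
     (\<forall>j t :: nat. 1 \<le> t \<and> t \<le> m \<and> 1 \<le> j \<longrightarrow>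
       mu m (int t) * (\<Prod>k=1..j - 1. mu m (int t) - mu (j - 1) (int k))
         = mu m (int j * int t) - mu m ((int j - 1) * int t)
     \<and> mu m (int j * int t) - mu m ((int j - 1) * int t)
         = phi m (int j * int t) - phi m ((int j - 1) * int t)
     \<and> mu m (int t) * (\<Prod>k=1..j. mu m (int t) - nu j k)
         = phi m ((int j + 1) * int t) - 2 * phi m (int j * int t) + phi m ((int j - 1) * int t))
     \<and>
     (\<forall>(j :: nat) (r :: int). 1 \<le> j \<and> j \<le> m \<longrightarrow>
       F_seq m j r
         = (\<Sum>t=1..m. mu m (int t) powi (- r)
             * (phi m (int j * int t) - phi m ((int j - 1) * int t)))
     \<and> G_seq m j r
         = (\<Sum>t=1..m. mu m (int t) powi (- r)
             * (phi m ((int j + 1) * int t) - 2 * phi m (int j * int t)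
                + phi m ((int j - 1) * int t))))"
proof (intro conjI allI impI; (elim conjE)?)
  fix j t :: nat
  show "mu m (int t) * poly (P_poly j) (mu m (int t))
      = mu m ((int j + 1) * int t) - mu m (int j * int t)"
    unfolding mu_times_P_poly by (simp add: mu_def)
  show "mu m (int t) * poly (Q_poly j) (mu m (int t))
      = mu m ((int j + 1) * int t) - 2 * mu m (int j * int t) + mu m ((int j - 1) * int t)"
    unfolding poly_Q_poly_mu mu_times_phi by (simp add: mu_def algebra_simps)
next
  fix j t :: nat
  let ?d = "phi m ((int m - int j + 1) * int t) - phi m ((int m - int j) * int t)"
  show eq: "phi m ((int m - 2 * int j + 1) * int t) - phi m ((int m - 2 * int j) * int t)
      = phi m (int j * int t) * ?d"
    by (rule phi_diff_half_step)
  assume "?d \<noteq> 0"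
  thus "(phi m ((int m - 2 * int j + 1) * int t) - phi m ((int m - 2 * int j) * int t)) / ?d
      = phi m (int j * int t)"
    by (simp add: eq)
next
  fix j t :: nat
  let ?d = "phi m ((int m - int j + 1) * int t) - phi m ((int m - int j) * int t)"
  show eq: "phi m ((2 * int j - int m) * int t) - phi m ((2 * int j - int m - 1) * int t)
      = - phi m (int j * int t) * ?d"
    by (rule phi_diff_half_step_reflected)
  assume "?d \<noteq> 0"
  thus "(phi m ((2 * int j - int m) * int t) - phi m ((2 * int j - int m - 1) * int t)) / ?d
      = - phi m (int j * int t)"
    by (simp add: eq)
next
  fix j t :: nat
  assume j: "1 \<le> j"
  have "int (j - 1) = int j - 1" using j by simp
  thus "mu m (int t) * (\<Prod>k=1..j - 1. mu m (int t) - mu (j - 1) (int k))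
      = mu m (int j * int t) - mu m ((int j - 1) * int t)"
    unfolding prod_mu_eq_P_poly mu_times_P_poly by (simp add: mu_def)
  show "mu m (int t) * (\<Prod>k=1..j. mu m (int t) - nu j k)
      = phi m ((int j + 1) * int t) - 2 * phi m (int j * int t) + phi m ((int j - 1) * int t)"
    unfolding prod_nu_eq_Q_poly[OF j] poly_Q_poly_mu mu_times_phi by (simp add: algebra_simps)
qed (simp_all add: mu_def F_seq_eq G_seq_eq)

end
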